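(* Let $D$ be a commutative ring, let $I$ be an integrally closed ideal of $D$, and set $R:=D/I$. Let $n\in\mathbb{N}$ and let $A$ be a $1$-principled $n\times n$-matrix over $R$. Then $A$ is $1$-nullcyclic.
   Context: All rings are commutative, associative and unital; $\mathbb{N}=\{0,1,2,\ldots\}$ and $[n]:=\{1,2,\ldots,n\}$. Let $A=(a_{i,j})_{i,j\in[n]}$ be a matrix over a ring $R$. For $S\subseteq[n]$, $A_S$ denotes the principal submatrix of $A$ with row and column set $S$; the empty determinant is $1$. $A$ is $1$-principled if $\det A_S=1$ for every $S\subseteq[n]$. A cycle on $[n]$ is a $k$-tuple $C=(i_1,i_2,\ldots,i_k)$ with $k>0$ and $i_1,\ldots,i_k$ distinct elements of $[n]$, considered up to cyclic rotation; it is nontrivial if $k>1$. The $A$-weight of a cycle $C=(i_1,\ldots,i_k)$ is $w_A(C):=a_{i_1,i_2}a_{i_2,i_3}\cdots a_{i_{k-1},i_k}a_{i_k,i_1}$. $A$ is nullcyclic if $w_A(C)=0$ for each nontrivial cycle $C$ on $[n]$; it is $1$-diagonal if all its diagonal entries equal $1$; it is $1$-nullcyclic if it is both $1$-diagonal and nullcyclic. For an ideal $I$ of a commutative ring $D$, an element $x\in D$ is integral over $I$ if there exist a positive integer $d$ and elements $c_j\in I^j$ for all $j\in[d]$ such that $x^d+c_1x^{d-1}+c_2x^{d-2}+\cdots+c_d=0$. The integral closure $\overline{I}$ is the set of all elements of $D$ integral over $I$, and $I$ is integrally closed if $\overline{I}=I$. *)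

theory Defs
  imports "HOL-Algebra.Algebra" "HOL-Combinatorics.Permutations"
begin

section \<open>Matrices over a ring and principal minors\<close>

text \<open>
  An $n \times n$ matrix is a function of type \<^typ>\<open>nat \<Rightarrow> nat \<Rightarrow> 'r\<close>, of which only the
  entries with both indices in \<open>{1..n}\<close> matter.
\<close>

definition matrix_over :: "('r, 'm) ring_scheme \<Rightarrow> nat \<Rightarrow> (nat \<Rightarrow> nat \<Rightarrow> 'r) \<Rightarrow> bool" where
  "matrix_over R n A \<longleftrightarrow> (\<forall>i\<in>{1..n}. \<forall>j\<in>{1..n}. A i j \<in> carrier R)"

text \<open>
  The determinant, by the Leibniz formula, of the principal submatrix of \<open>A\<close> with row and
  column set \<open>S\<close>, for finite \<open>S\<close>. No library determinant applies, as those are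
  for type-class rings, whereas here the entries lie in a ring given by a carrier (a quotient
  ring, possibly the zero ring). For empty \<open>S\<close> the only permutation is the identity, and the
  determinant is the empty product, that is, one.
\<close>

definition principal_minor ::
    "('r, 'm) ring_scheme \<Rightarrow> (nat \<Rightarrow> nat \<Rightarrow> 'r) \<Rightarrow> nat set \<Rightarrow> 'r" where
  "principal_minor R A S =
     (\<Oplus>\<^bsub>R\<^esub> p \<in> {p. p permutes S}. add_pow R (sign p) (\<Otimes>\<^bsub>R\<^esub> i \<in> S. A i (p i)))"

definition one_principled :: "('r, 'm) ring_scheme \<Rightarrow> nat \<Rightarrow> (nat \<Rightarrow> nat \<Rightarrow> 'r) \<Rightarrow> bool" where
  "one_principled R n A \<longleftrightarrow> (\<forall>S. S \<subseteq> {1..n} \<longrightarrow> principal_minor R A S = \<one>\<^bsub>R\<^esub>)"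


section \<open>Cycles\<close>

text \<open>
  A cycle is represented by any of the lists in its class up to rotation. The weight of a
  cycle in a commutative ring and its nontriviality do not depend on the representative.
\<close>

definition is_cycle :: "nat \<Rightarrow> nat list \<Rightarrow> bool" where
  "is_cycle n C \<longleftrightarrow> length C > 0 \<and> distinct C \<and> set C \<subseteq> {1..n}"

definition nontrivial_cycle :: "nat \<Rightarrow> nat list \<Rightarrow> bool" where
  "nontrivial_cycle n C \<longleftrightarrow> is_cycle n C \<and> length C > 1"

definition cycle_weight :: "('r, 'm) ring_scheme \<Rightarrow> (nat \<Rightarrow> nat \<Rightarrow> 'r) \<Rightarrow> nat list \<Rightarrow> 'r" where
  "cycle_weight R A C =
     (\<Otimes>\<^bsub>R\<^esub> k \<in> {..<length C}. A (C ! k) (C ! (Suc k mod length C)))"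

definition nullcyclic :: "('r, 'm) ring_scheme \<Rightarrow> nat \<Rightarrow> (nat \<Rightarrow> nat \<Rightarrow> 'r) \<Rightarrow> bool" where
  "nullcyclic R n A \<longleftrightarrow> (\<forall>C. nontrivial_cycle n C \<longrightarrow> cycle_weight R A C = \<zero>\<^bsub>R\<^esub>)"

definition one_diagonal :: "('r, 'm) ring_scheme \<Rightarrow> nat \<Rightarrow> (nat \<Rightarrow> nat \<Rightarrow> 'r) \<Rightarrow> bool" where
  "one_diagonal R n A \<longleftrightarrow> (\<forall>i\<in>{1..n}. A i i = \<one>\<^bsub>R\<^esub>)"

definition one_nullcyclic :: "('r, 'm) ring_scheme \<Rightarrow> nat \<Rightarrow> (nat \<Rightarrow> nat \<Rightarrow> 'r) \<Rightarrow> bool" where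
  "one_nullcyclic R n A \<longleftrightarrow> one_diagonal R n A \<and> nullcyclic R n A"


section \<open>Integral closure of an ideal\<close>

text \<open>
  \<open>I [^]\<^bsub>ideals_set D\<^esub> j\<close> is the \<open>j\<close>-th power of the ideal \<open>I\<close>: \<^const>\<open>ideals_set\<close> is the
  semiring of ideals of \<open>D\<close>, whose multiplication is \<^const>\<open>ideal_prod\<close>.
\<close>

definition integral_over_ideal :: "('a, 'b) ring_scheme \<Rightarrow> 'a set \<Rightarrow> 'a \<Rightarrow> bool" where
  "integral_over_ideal D I x \<longleftrightarrow>
     (\<exists>(d::nat) c. d > 0 \<and> (\<forall>j\<in>{1..d}. c j \<in> I [^]\<^bsub>ideals_set D\<^esub> j) \<and>
        x [^]\<^bsub>D\<^esub> d \<oplus>\<^bsub>D\<^esub> (\<Oplus>\<^bsub>D\<^esub> j \<in> {1..d}. c j \<otimes>\<^bsub>D\<^esub> x [^]\<^bsub>D\<^esub> (d - j)) = \<zero>\<^bsub>D\<^esub>)"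

definition ideal_integral_closure :: "('a, 'b) ring_scheme \<Rightarrow> 'a set \<Rightarrow> 'a set" where
  "ideal_integral_closure D I = {x \<in> carrier D. integral_over_ideal D I x}"

definition integrally_closed_ideal :: "('a, 'b) ring_scheme \<Rightarrow> 'a set \<Rightarrow> bool" where
  "integrally_closed_ideal D I \<longleftrightarrow> ideal_integral_closure D I = I"

end

theory Submission
  imports Defs "HOL-Combinatorics.Cycles"
begin

text \<open>
  The diagonal entries of \<open>A\<close> are one because they are principal minors of size one. The weights of
  the nontrivial cycles vanish by induction on the length of the cycle. Lift \<open>A\<close> to a matrix \<open>a\<close> over
  \<open>D\<close>; then "vanish" means that the weights for \<open>a\<close> lie in \<open>I\<close>. Let \<open>S\<close> be the set of vertices of a
  cycle of length \<open>n \<ge> 2\<close>, and assume the claim for all shorter nontrivial cycles.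

  \<^item> In the Leibniz formula for \<open>det A\<^sub>S = 1\<close>, the identity contributes one, and every permutation that
    is neither the identity nor a cycle through all of \<open>S\<close> contributes zero, as it has a shorter
    nontrivial cycle. Hence the signed weights \<open>t\<^sub>p\<close> of the permutations \<open>p\<close> that are cycles through all
    of \<open>S\<close> have a sum \<open>s\<close> in \<open>I\<close> (\<open>finsum_full_cycles_eq_zero\<close>).
  \<^item> If \<open>p\<close> and \<open>q\<close> are different such permutations, then \<open>t\<^sub>p t\<^sub>q\<close> lies in \<open>I\<^sup>2\<close>. Run through the two
    cycles one after the other, from a common start. As the cycles differ, some vertex occurs in them
    at two different positions, and cutting this closed walk of length \<open>2n\<close> there gives two closed
    walks whose lengths are not divisible by \<open>n\<close> (\<open>distinct_cycles_weight_mem_ideal_prod\<close>). The weight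
    of such a walk lies in \<open>I\<close>: cut it at repeated vertices, each time keeping a piece whose length is
    not divisible by \<open>n\<close>; at the end the piece is a cycle shorter than \<open>n\<close>.
    Loops may appear, but they have weight zero if the diagonal of \<open>a\<close> is first replaced by zeros
    (\<open>closed_walk_weight_mem_ideal\<close>).

  Multiplying \<open>s\<close> by \<open>t\<^sub>q\<close> gives \<open>t\<^sub>q\<^sup>2 - s t\<^sub>q + c = 0\<close>, where \<open>c\<close> is the sum of all \<open>t\<^sub>p t\<^sub>q\<close> with
  \<open>p \<noteq> q\<close>. Since \<open>s \<in> I\<close> and \<open>c \<in> I\<^sup>2\<close>, this is an equation of integral dependence over \<open>I\<close>
  (\<open>integral_over_ideal_leibniz_term\<close>), and so \<open>t\<^sub>q \<in> I\<close>.
\<close>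

section \<open>Weights of closed walks\<close>

text \<open>
  A closed walk is given, like a cycle, by the list of its vertices, which may repeat; its weight is
  its \<^const>\<open>cycle_weight\<close>. The weight of a walk that leaves the list for the vertex \<open>y\<close> is multiplicative
  for concatenation, which makes closed walks easy to cut and to rotate.
\<close>
fun path_weight :: "('r, 'm) ring_scheme \<Rightarrow> (nat \<Rightarrow> nat \<Rightarrow> 'r) \<Rightarrow> nat list \<Rightarrow> nat \<Rightarrow> 'r" where
  "path_weight R A [] y = \<one>\<^bsub>R\<^esub>"
| "path_weight R A (x # xs) y = A x (hd (xs @ [y])) \<otimes>\<^bsub>R\<^esub> path_weight R A xs y"

context cring
begin

lemma path_weight_closed [simp]:
  assumes "\<forall>i j. A i j \<in> carrier R"
  shows "path_weight R A xs y \<in> carrier R"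
  using assms by (induction xs) auto

lemma path_weight_append:
  assumes "\<forall>i j. A i j \<in> carrier R"
  shows "path_weight R A (xs @ ys) z = path_weight R A xs (hd (ys @ [z])) \<otimes> path_weight R A ys z"
proof (induction xs)
  case (Cons x xs)
  have "hd ((xs @ ys) @ [z]) = hd (xs @ [hd (ys @ [z])])"
    by (cases xs) auto
  with Cons show ?case
    using assms by (simp add: m_assoc)
qed (use assms in simp)

lemma path_weight_eq_finprod:
  assumes "\<forall>i j. A i j \<in> carrier R"
  shows "path_weight R A xs y
    = (\<Otimes>k\<in>{..<length xs}. A (xs ! k) ((xs @ [y]) ! Suc k))"
proof (induction xs)
  case (Cons x xs)
  let ?f = "\<lambda>k. A ((x # xs) ! k) ((x # xs @ [y]) ! Suc k)"
  have "(\<Otimes>k\<in>{..<length (x # xs)}. ?f k) = (\<Otimes>k\<in>insert 0 (Suc ` {..<length xs}). ?f k)"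
    by (simp add: lessThan_Suc_eq_insert_0)
  also have "\<dots> = ?f 0 \<otimes> (\<Otimes>k\<in>Suc ` {..<length xs}. ?f k)"
    using assms by (subst finprod_insert) auto
  also have "(\<Otimes>k\<in>Suc ` {..<length xs}. ?f k) = (\<Otimes>k\<in>{..<length xs}. ?f (Suc k))"
    using assms by (subst finprod_reindex) auto
  finally show ?case
    using Cons by (simp add: hd_conv_nth)
qed simp

lemma cycle_weight_eq_path_weight:
  assumes A: "\<forall>i j. A i j \<in> carrier R" and "C \<noteq> []"
  shows "cycle_weight R A C = path_weight R A C (hd C)"
  unfolding cycle_weight_def path_weight_eq_finprod[OF A]
proof (rule finprod_cong')
  fix k assume "k \<in> {..<length C}"
  then show "A (C ! k) (C ! (Suc k mod length C)) = A (C ! k) ((C @ [hd C]) ! Suc k)"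
    using assms by (cases "Suc k = length C") (auto simp: nth_append hd_conv_nth)
qed (use A in auto)

lemma cycle_weight_closed [simp]:
  assumes "\<forall>i j. A i j \<in> carrier R"
  shows "cycle_weight R A C \<in> carrier R"
  unfolding cycle_weight_def using assms by (intro finprod_closed) auto

lemma cycle_weight_cong:
  assumes "\<And>i j. i \<in> set C \<Longrightarrow> j \<in> set C \<Longrightarrow> A i j = B i j" "\<forall>i j. B i j \<in> carrier R"
  shows "cycle_weight R A C = cycle_weight R B C"
  unfolding cycle_weight_def
proof (rule finprod_cong')
  fix k assume "k \<in> {..<length C}"
  then have "C ! k \<in> set C" "C ! (Suc k mod length C) \<in> set C"
    by (auto intro!: nth_mem mod_less_divisor)
  then show "A (C ! k) (C ! (Suc k mod length C)) = B (C ! k) (C ! (Suc k mod length C))"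
    by (rule assms(1))
qed (use assms in auto)

lemma cycle_weight_append:
  assumes A: "\<forall>i j. A i j \<in> carrier R" and "xs \<noteq> []" "ys \<noteq> []" "hd xs = hd ys"
  shows "cycle_weight R A (xs @ ys) = cycle_weight R A xs \<otimes> cycle_weight R A ys"
  using assms by (simp add: cycle_weight_eq_path_weight path_weight_append)

text \<open>
  A closed walk that visits \<open>z\<close> twice consists of two closed walks through \<open>z\<close>. The second one is
  written from \<open>z\<close> on, so that it passes through the end of the list and back to its start.
\<close>
lemma cycle_weight_split:
  assumes A: "\<forall>i j. A i j \<in> carrier R"
  shows "cycle_weight R A (u @ z # v @ z # w)
    = cycle_weight R A (z # v) \<otimes> cycle_weight R A ((z # w) @ u)"
proof -
  define h where "h = hd (u @ [z])"
  have h: "hd (u @ z # v @ z # w) = h" "hd (u @ [z]) = h"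
    unfolding h_def by (cases u; simp)+
  have "cycle_weight R A (u @ z # v @ z # w)
      = path_weight R A u z \<otimes> (path_weight R A (z # v) z \<otimes> path_weight R A (z # w) h)"
    using path_weight_append[OF A, of u "(z # v) @ (z # w)" h]
      path_weight_append[OF A, of "z # v" "z # w" h]
    by (simp add: cycle_weight_eq_path_weight[OF A] h)
  moreover have "cycle_weight R A ((z # w) @ u) = path_weight R A (z # w) h \<otimes> path_weight R A u z"
    using path_weight_append[OF A, of "z # w" u z]
    by (simp add: cycle_weight_eq_path_weight[OF A] h)
  moreover have "cycle_weight R A (z # v) = path_weight R A (z # v) z"
    by (simp add: cycle_weight_eq_path_weight[OF A])
  ultimately show ?thesis
    using path_weight_closed[OF A] by (simp only: m_ac m_closed)
qed

text \<open>
  If a walk repeats a vertex, it is cut there. The lengths of the two pieces add up to a number that is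
  not a multiple of \<open>card S\<close>, so this also holds for the length of one of the pieces, and induction
  applies to it. If no vertex repeats, the walk is a cycle that misses a vertex of \<open>S\<close>. The cycles
  in the hypothesis include those of length one, as cutting a walk may produce loops.
\<close>
lemma closed_walk_weight_mem_ideal:
  assumes A: "\<forall>i j. A i j \<in> carrier R" and I: "ideal I R" and "finite S"
    and short: "\<And>C. C \<noteq> [] \<Longrightarrow> distinct C \<Longrightarrow> set C \<subset> S \<Longrightarrow> cycle_weight R A C \<in> I"
    and "set L \<subseteq> S" and "\<not> card S dvd length L"
  shows "cycle_weight R A L \<in> I"
  using assms(5,6)
proof (induction "length L" arbitrary: L rule: less_induct)
  case less
  interpret ideal I R by (fact I)
  show ?case
  proof (cases "distinct L")
    case True
    with less.prems have "set L \<noteq> S" "L \<noteq> []"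
      by (auto simp flip: distinct_card)
    with True less.prems short show ?thesis by blast
  next
    case False
    then obtain u v w z where L: "L = u @ [z] @ v @ [z] @ w"
      using not_distinct_decomp by blast
    have *: "cycle_weight R A L = cycle_weight R A (z # v) \<otimes> cycle_weight R A ((z # w) @ u)"
      using cycle_weight_split[OF A, of u z v w] by (simp add: L)
    have "length L = length (z # v) + length ((z # w) @ u)"
      by (simp add: L)
    with less.prems(2) have "\<not> card S dvd length (z # v) \<or> \<not> card S dvd length ((z # w) @ u)"
      by (metis dvd_add)
    then show ?thesis
    proof
      assume "\<not> card S dvd length (z # v)"
      then have "cycle_weight R A (z # v) \<in> I"
        using less.prems(1) by (intro less.hyps) (auto simp: L)
      then show ?thesis
        unfolding * by (intro I_r_closed cycle_weight_closed A)
    next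
      assume "\<not> card S dvd length ((z # w) @ u)"
      then have "cycle_weight R A ((z # w) @ u) \<in> I"
        using less.prems(1) by (intro less.hyps) (auto simp: L)
      then show ?thesis
        unfolding * by (intro I_l_closed cycle_weight_closed A)
    qed
  qed
qed

text \<open>
  The closed walk \<open>xs @ ys\<close> is cut at a vertex whose position \<open>l\<close> in \<open>xs\<close> differs from its position
  \<open>k\<close> in \<open>ys\<close>. The pieces have lengths \<open>card S - l + k\<close> and \<open>card S - k + l\<close>. As \<open>l\<close> and \<open>k\<close> are different
  and less than \<open>card S\<close>, neither is a multiple of \<open>card S\<close>, so each piece has its weight in \<open>I\<close>.
\<close>
lemma distinct_cycles_weight_mem_ideal_prod:
  assumes A: "\<forall>i j. A i j \<in> carrier R" and I: "ideal I R" and "finite S"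
    and short: "\<And>C. C \<noteq> [] \<Longrightarrow> distinct C \<Longrightarrow> set C \<subset> S \<Longrightarrow> cycle_weight R A C \<in> I"
    and xs: "distinct xs" "set xs = S" "xs \<noteq> []"
    and ys: "distinct ys" "set ys = S"
    and "hd xs = hd ys" "xs \<noteq> ys"
  shows "cycle_weight R A xs \<otimes> cycle_weight R A ys \<in> I \<cdot> I"
proof -
  have len: "length xs = card S" "length ys = card S"
    using xs ys by (auto simp flip: distinct_card)
  with \<open>xs \<noteq> ys\<close> obtain k where k: "k < card S" "xs ! k \<noteq> ys ! k"
    by (metis nth_equalityI)
  define z where "z = ys ! k"
  have "z \<in> set xs"
    using k(1) len(2) xs(2) ys(2) nth_mem[of k ys] by (simp add: z_def)
  then obtain l where l: "l < card S" "xs ! l = z"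
    using len by (metis in_set_conv_nth)
  have "l \<noteq> k"
    using l k z_def by auto
  define u u' v v'
    where "u = take l xs" and "u' = drop (Suc l) xs" and "v = take k ys" and "v' = drop (Suc k) ys"
  have xs_ys: "xs = u @ z # u'" "ys = v @ z # v'"
    using id_take_nth_drop[of l xs] id_take_nth_drop[of k ys] l k(1) len
    by (simp_all add: u_def u'_def v_def v'_def z_def)
  have lens: "length u = l" "length u' = card S - Suc l"
      "length v = k" "length v' = card S - Suc k"
    using l k len by (auto simp: u_def u'_def v_def v'_def)
  have nd: "\<not> n dvd Suc (n - Suc i + j)" if "i < n" "j < n" "i \<noteq> j" for n i j :: nat
  proof
    assume "n dvd Suc (n - Suc i + j)"
    then obtain c where c: "Suc (n - Suc i + j) = n * c" by (elim dvdE)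
    then have "n + j = n * c + i" using that by linarith
    then have "(n + j) mod n = (n * c + i) mod n" by simp
    with that show False by simp
  qed
  have "cycle_weight R A xs \<otimes> cycle_weight R A ys = cycle_weight R A (xs @ ys)"
    using assms by (subst cycle_weight_append) auto
  also have "xs @ ys = u @ z # (u' @ v) @ z # v'"
    by (simp add: xs_ys)
  also have "cycle_weight R A \<dots>
      = cycle_weight R A (z # u' @ v) \<otimes> cycle_weight R A ((z # v') @ u)"
    by (rule cycle_weight_split[OF A])
  also have "\<dots> \<in> I \<cdot> I"
  proof (rule ideal_prod.prod; rule closed_walk_weight_mem_ideal[OF A I \<open>finite S\<close> short])
    show "set (z # u' @ v) \<subseteq> S" "set ((z # v') @ u) \<subseteq> S"
      using xs(2) ys(2) xs_ys by auto
    show "\<not> card S dvd length (z # u' @ v)" "\<not> card S dvd length ((z # v') @ u)"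
      using nd[of l "card S" k] nd[of k "card S" l] l k \<open>l \<noteq> k\<close> by (auto simp: lens)
  qed
  finally show ?thesis .
qed

end


context ring_hom_cring
begin

lemma hom_cycle_weight:
  assumes "\<forall>i j. A i j \<in> carrier R"
  shows "h (cycle_weight R A C) = cycle_weight S (\<lambda>i j. h (A i j)) C"
  unfolding cycle_weight_def using assms by (subst hom_finprod) (auto simp: comp_def)

end


section \<open>Cycles of permutations\<close>

definition traverses :: "(nat \<Rightarrow> nat) \<Rightarrow> nat list \<Rightarrow> bool" where
  "traverses p C \<longleftrightarrow> C \<noteq> [] \<and> distinct C \<and> (\<forall>k<length C. p (C ! k) = C ! (Suc k mod length C))"

definition full_cycles :: "nat set \<Rightarrow> (nat \<Rightarrow> nat) set" where
  "full_cycles S = {p. p permutes S \<and> (\<exists>C. traverses p C \<and> set C = S)}"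

lemma finite_full_cycles: "finite S \<Longrightarrow> finite (full_cycles S)"
  by (rule finite_subset[OF _ finite_permutations[of S]]) (auto simp: full_cycles_def)

lemma traverses_through:
  assumes "p permutes S" "finite S" "x \<in> S"
  obtains C where "traverses p C" "hd C = x" "set C \<subseteq> S"
proof
  let ?C = "support p x"
  have p: "permutation p"
    using assms permutation_permutes by blast
  define m where "m = least_power p x"
  have m: "m > 0" "(p ^^ m) x = x"
    unfolding m_def by (rule least_power_of_permutation[OF p])+
  show "traverses p ?C"
    unfolding traverses_def
  proof (intro conjI allI impI)
    show "?C \<noteq> []" "distinct ?C"
      using m cycle_of_permutation[OF p] by (auto simp: m_def)
    fix k assume "k < length ?C"
    then have k: "k < m" by (simp add: m_def)
    then show "p (?C ! k) = ?C ! (Suc k mod length ?C)"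
      using m by (cases "Suc k = m") (auto simp flip: m_def)
  qed
  show "hd ?C = x"
    using m by (simp add: m_def hd_map)
  have "(p ^^ k) x \<in> S" for k
    using assms by (induction k) (auto simp: permutes_in_image)
  then show "set ?C \<subseteq> S" by auto
qed

lemma traverses_rotate:
  assumes "traverses p C" "x \<in> set C"
  obtains C' where "traverses p C'" "hd C' = x" "set C' = set C"
proof -
  obtain m where m: "m < length C" "C ! m = x"
    using assms by (auto simp: in_set_conv_nth)
  have "traverses p (rotate m C)"
    using assms m unfolding traverses_def
    by (auto simp: nth_rotate mod_simps)
  moreover have "hd (rotate m C) = x"
    using m assms by (simp add: hd_rotate_conv_nth traverses_def)
  ultimately show ?thesis
    using that by simp
qed

lemma ex_traverses:
  assumes "distinct C" "C \<noteq> []"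
  obtains p where "p permutes set C" "traverses p C"
proof
  show "cycle_of_list C permutes set C"
    by (rule cycle_permutes)
  have "cycle_of_list C (C ! k) = C ! (Suc k mod length C)" if "k < length C" for k
  proof -
    have "cycle_of_list C (C ! k) = map (cycle_of_list C ^^ 1) C ! k"
      using that by simp
    also have "\<dots> = rotate 1 C ! k"
      by (simp only: cyclic_rotation[OF assms(1)])
    also have "\<dots> = C ! (Suc k mod length C)"
      using that by (simp only: nth_rotate) simp
    finally show ?thesis .
  qed
  with assms show "traverses (cycle_of_list C) C"
    by (simp add: traverses_def)
qed

lemma traverses_unique:
  assumes "traverses p C" "traverses q C" "p permutes set C" "q permutes set C"
  shows "p = q"
proof
  fix x
  show "p x = q x"
  proof (cases "x \<in> set C")
    case True
    then show ?thesis
      using assms(1,2) by (auto simp: in_set_conv_nth traverses_def)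
  next
    case False
    then show ?thesis
      using assms(3,4) by (simp add: permutes_not_in)
  qed
qed

lemma permutes_obtains_short_cycle:
  assumes "p permutes S" "finite S" "p \<noteq> id" "p \<notin> full_cycles S"
  obtains C where "traverses p C" "set C \<subset> S" "length C \<ge> 2"
proof -
  obtain x where x: "p x \<noteq> x"
    using assms by (auto simp: fun_eq_iff)
  then have "x \<in> S"
    using assms by (meson permutes_not_in)
  then obtain C where C: "traverses p C" "hd C = x" "set C \<subseteq> S"
    using traverses_through assms by metis
  moreover have "set C \<noteq> S"
    using C assms by (auto simp: full_cycles_def)
  moreover have "length C \<ge> 2"
  proof (rule ccontr)
    assume "\<not> length C \<ge> 2"
    with C obtain y where "C = [y]"
      by (cases C; cases "tl C") (auto simp: traverses_def)
    with C x show False by (simp add: traverses_def)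
  qed
  ultimately show ?thesis
    by (intro that[of C]) auto
qed

context cring
begin

lemma finprod_traverses:
  assumes A: "\<forall>i j. A i j \<in> carrier R" and "traverses p C"
  shows "(\<Otimes>i\<in>set C. A i (p i)) = cycle_weight R A C"
proof -
  have "set C = (!) C ` {..<length C}"
    by (auto simp: set_conv_nth)
  then have "(\<Otimes>i\<in>set C. A i (p i)) = (\<Otimes>i\<in>(!) C ` {..<length C}. A i (p i))"
    by simp
  also have "\<dots> = (\<Otimes>k\<in>{..<length C}. A (C ! k) (p (C ! k)))"
    using assms by (subst finprod_reindex) (auto simp: traverses_def inj_on_nth)
  also have "\<dots> = cycle_weight R A C"
    unfolding cycle_weight_def
    using assms by (intro finprod_cong') (auto simp: traverses_def)
  finally show ?thesis .
qed

end


section \<open>The Leibniz sum\<close>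

definition leibniz_term ::
    "('r, 'm) ring_scheme \<Rightarrow> (nat \<Rightarrow> nat \<Rightarrow> 'r) \<Rightarrow> nat set \<Rightarrow> (nat \<Rightarrow> nat) \<Rightarrow> 'r" where
  "leibniz_term R A S p = add_pow R (sign p) (\<Otimes>\<^bsub>R\<^esub> i \<in> S. A i (p i))"

context cring
begin

lemma add_pow_sign:
  assumes "x \<in> carrier R"
  shows "add_pow R (sign p) x = (if evenperm p then x else \<ominus> x)"
  using assms by (simp add: sign_def add_pow_int_ge add_pow_int_lt)

lemma add_pow_sign_closed:
  "x \<in> carrier R \<Longrightarrow> add_pow R (sign p) x \<in> carrier R"
  by (simp add: add_pow_sign)

lemma leibniz_term_closed [simp]:
  assumes "\<forall>i j. A i j \<in> carrier R"
  shows "leibniz_term R A S p \<in> carrier R"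
  using assms by (auto simp: leibniz_term_def intro!: add.int_pow_closed finprod_closed)

lemma principal_minor_singleton:
  assumes "A i i \<in> carrier R"
  shows "principal_minor R A {i} = A i i"
proof -
  have "{p. p permutes {i}} = {id}"
    by auto
  with assms show ?thesis
    by (simp add: principal_minor_def add_pow_sign evenperm_id)
qed

lemma principal_minor_cong:
  assumes "\<And>i j. i \<in> S \<Longrightarrow> j \<in> S \<Longrightarrow> A i j = B i j" "\<forall>i j. B i j \<in> carrier R"
  shows "principal_minor R A S = principal_minor R B S"
proof -
  have "(\<Otimes>i\<in>S. A i (p i)) = (\<Otimes>i\<in>S. B i (p i))" if "p permutes S" for p
    using assms that by (intro finprod_cong') (auto simp: permutes_in_image)
  moreover have "leibniz_term R B S p \<in> carrier R" for p
    using assms by simp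
  ultimately show ?thesis
    unfolding principal_minor_def by (intro finsum_cong') (auto simp: leibniz_term_def)
qed

text \<open>
  A permutation other than the identity and the full cycles moves the vertices of some nontrivial cycle
  that misses a vertex of \<open>S\<close>; the weight of this cycle is a factor of its Leibniz term. So the Leibniz
  formula reads \<open>1 = 1 + \<dots>\<close>, where only the full cycles contribute to the dots.
\<close>
lemma finsum_full_cycles_eq_zero:
  assumes A: "\<forall>i j. A i j \<in> carrier R" and S: "finite S" "card S \<ge> 2"
    and diag: "\<And>i. i \<in> S \<Longrightarrow> A i i = \<one>"
    and short: "\<And>C. distinct C \<Longrightarrow> length C \<ge> 2 \<Longrightarrow> set C \<subset> S \<Longrightarrow> cycle_weight R A C = \<zero>"
    and minor: "principal_minor R A S = \<one>"
  shows "(\<Oplus>p\<in>full_cycles S. leibniz_term R A S p) = \<zero>"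
proof -
  let ?t = "leibniz_term R A S"
  let ?F = "full_cycles S"
  define N where "N = {p. p permutes S} - ?F - {id}"
  have t: "?t \<in> B \<rightarrow> carrier R" for B
    using A by simp
  have fin: "finite ?F" "finite N"
    using S finite_permutations[of S] by (auto simp: finite_full_cycles N_def)
  have "id \<notin> ?F"
  proof
    assume "id \<in> ?F"
    then obtain C where C: "traverses id C" "set C = S"
      by (auto simp: full_cycles_def)
    then have len: "length C \<ge> 2" and "distinct C"
      using S by (auto simp: traverses_def distinct_card)
    from C(1) len have "C ! 0 = C ! (1 mod length C)"
      unfolding traverses_def by (metis One_nat_def id_apply length_greater_0_conv)
    with len \<open>distinct C\<close> show False
      using nth_eq_iff_index_eq[of C 0 1] by (cases "C = []") auto
  qed
  moreover have "{p. p permutes S} = insert id (?F \<union> N)"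
    using permutes_id[of S] by (auto simp: N_def full_cycles_def)
  moreover have "id \<notin> N" "?F \<inter> N = {}"
    by (auto simp: N_def)
  ultimately have "principal_minor R A S = ?t id \<oplus> (finsum R ?t ?F \<oplus> finsum R ?t N)"
    unfolding principal_minor_def leibniz_term_def[symmetric]
    using t fin A by (simp add: finsum_insert finsum_Un_disjoint)
  moreover have "finsum R ?t N = \<zero>"
  proof (rule add.finprod_one_eqI)
    fix p assume "p \<in> N"
    then have p: "p permutes S" "p \<noteq> id" "p \<notin> ?F"
      by (auto simp: N_def)
    from permutes_obtains_short_cycle[OF p(1) S(1) p(2,3)] obtain C
      where C: "traverses p C" "set C \<subset> S" "length C \<ge> 2" .
    have "(\<Otimes>i\<in>set C \<union> (S - set C). A i (p i))
        = (\<Otimes>i\<in>set C. A i (p i)) \<otimes> (\<Otimes>i\<in>S - set C. A i (p i))"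
      using S A by (intro finprod_Un_disjoint) auto
    also have "(\<Otimes>i\<in>set C. A i (p i)) = \<zero>"
      using C short by (simp add: finprod_traverses[OF A] traverses_def)
    also have "set C \<union> (S - set C) = S"
      using C by auto
    finally show "?t p = \<zero>"
      using A by (simp add: leibniz_term_def add_pow_sign)
  qed
  moreover have "?t id = \<one>"
  proof -
    have "(\<Otimes>i\<in>S. A i (id i)) = \<one>"
      using diag by (intro finprod_one_eqI) auto
    then show ?thesis
      by (simp add: leibniz_term_def add_pow_sign evenperm_id)
  qed
  ultimately have "\<one> = \<one> \<oplus> finsum R ?t ?F"
    using minor t by (simp add: finsum_closed)
  then show ?thesis
    using t by (simp add: finsum_closed)
qed

lemma leibniz_term_set:
  assumes A: "\<forall>i j. A i j \<in> carrier R" and "traverses p C"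
  shows "leibniz_term R A (set C) p = add_pow R (sign p) (cycle_weight R A C)"
  using finprod_traverses[OF assms] by (simp add: leibniz_term_def)

end


context ring_hom_cring
begin

lemma hom_leibniz_term:
  assumes A: "\<forall>i j. A i j \<in> carrier R"
  shows "h (leibniz_term R A T p) = leibniz_term S (\<lambda>i j. h (A i j)) T p"
proof -
  have "h (\<Otimes>i\<in>T. A i (p i)) = (\<Otimes>\<^bsub>S\<^esub>i\<in>T. h (A i (p i)))"
    using A by (subst hom_finprod) (auto simp: comp_def)
  moreover have "(\<Otimes>i\<in>T. A i (p i)) \<in> carrier R"
    using A by (intro R.finprod_closed) auto
  moreover from this have "h (\<Otimes>i\<in>T. A i (p i)) \<in> carrier S"
    by (rule hom_closed)
  ultimately show ?thesis
    unfolding leibniz_term_def by (simp add: R.add_pow_sign S.add_pow_sign)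
qed

end


section \<open>An integral equation for the weight of a cycle\<close>

context cring
begin

lemma finsum_mem_ideal:
  assumes "ideal J R" "f \<in> B \<rightarrow> J"
  shows "(\<Oplus>x\<in>B. f x) \<in> J"
proof -
  interpret J: ideal J R by fact
  have "f \<in> B \<rightarrow> J \<Longrightarrow> (\<Oplus>x\<in>B. f x) \<in> J"
  proof (induction B rule: infinite_finite_induct)
    case (insert x F)
    then have "f \<in> F \<rightarrow> carrier R" "f x \<in> carrier R"
      by (auto intro: J.Icarr)
    with insert show ?case
      by (simp add: finsum_insert J.a_closed)
  qed (auto simp: finsum_infinite)
  with assms show ?thesis by blast
qed

lemma add_pow_sign_mem_ideal_iff:
  assumes "ideal J R" "x \<in> carrier R"
  shows "add_pow R (sign p) x \<in> J \<longleftrightarrow> x \<in> J"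
proof -
  interpret J: ideal J R by fact
  have "\<ominus> x \<in> J \<longleftrightarrow> x \<in> J"
    using assms J.a_inv_closed by (metis minus_minus)
  then show ?thesis
    using assms by (simp add: add_pow_sign)
qed

text \<open>
  Nothing is known about the diagonal entries here, while the cutting of closed walks may produce
  loops. The cycles in question only use off-diagonal entries, so the diagonal can be replaced by zeros;
  then the loops have weight zero.
\<close>
lemma leibniz_term_mult_mem_ideal_prod:
  assumes A: "\<forall>i j. A i j \<in> carrier R" and I: "ideal I R" and S: "finite S" "card S \<ge> 2"
    and short: "\<And>C. distinct C \<Longrightarrow> length C \<ge> 2 \<Longrightarrow> set C \<subset> S \<Longrightarrow> cycle_weight R A C \<in> I"
    and p: "p \<in> full_cycles S" and q: "q \<in> full_cycles S" and "p \<noteq> q"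
  shows "leibniz_term R A S p \<otimes> leibniz_term R A S q \<in> I \<cdot> I"
proof -
  interpret I: ideal I R by (fact I)
  define B where "B i j = (if i = j then \<zero> else A i j)" for i j
  have B: "\<forall>i j. B i j \<in> carrier R"
    using A by (simp add: B_def)
  have BA: "cycle_weight R B C = cycle_weight R A C" if "distinct C" "length C \<ge> 2" for C
    unfolding cycle_weight_def
  proof (rule finprod_cong')
    fix k assume "k \<in> {..<length C}"
    moreover from this have "Suc k mod length C \<noteq> k" "Suc k mod length C < length C"
      using that by (cases "Suc k = length C"; auto)+
    ultimately have "C ! k \<noteq> C ! (Suc k mod length C)"
      using that by (metis lessThan_iff nth_eq_iff_index_eq)
    then show "B (C ! k) (C ! (Suc k mod length C)) = A (C ! k) (C ! (Suc k mod length C))"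
      by (simp add: B_def)
  qed (use A in auto)
  have shortB: "cycle_weight R B C \<in> I" if C: "C \<noteq> []" "distinct C" "set C \<subset> S" for C
  proof (cases "length C \<ge> 2")
    case True
    with C short BA show ?thesis by simp
  next
    case False
    with C obtain x where "C = [x]"
      by (cases C; cases "tl C") auto
    then show ?thesis
      by (simp add: cycle_weight_def B_def lessThan_Suc)
  qed
  obtain xs where xs: "traverses p xs" "set xs = S" and "p permutes S"
    using p by (auto simp: full_cycles_def)
  obtain ys' where ys': "traverses q ys'" "set ys' = S" and "q permutes S"
    using q by (auto simp: full_cycles_def)
  \<comment> \<open>The two vertex lists have to start at the same vertex.\<close>
  have "hd xs \<in> set ys'"
    using xs ys' by (auto simp: traverses_def)
  with ys' obtain ys where ys: "traverses q ys" "hd ys = hd xs" "set ys = S"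
    using traverses_rotate by metis
  have "xs \<noteq> ys"
    using traverses_unique xs ys \<open>p \<noteq> q\<close> \<open>p permutes S\<close> \<open>q permutes S\<close> by blast
  have dist: "distinct xs" "distinct ys" "xs \<noteq> []"
    using xs ys by (auto simp: traverses_def)
  have "cycle_weight R B xs \<otimes> cycle_weight R B ys \<in> I \<cdot> I"
    using dist xs ys \<open>xs \<noteq> ys\<close>
    by (intro distinct_cycles_weight_mem_ideal_prod[OF B I \<open>finite S\<close> shortB]) auto
  moreover have "length xs = card S" "length ys = card S"
    using dist xs ys by (auto simp flip: distinct_card)
  ultimately have "cycle_weight R A xs \<otimes> cycle_weight R A ys \<in> I \<cdot> I"
    using dist S BA by simp
  then show ?thesis
    using leibniz_term_set[OF A xs(1)] leibniz_term_set[OF A ys(1)] A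
    by (simp add: xs ys add_pow_ldistr_int add_pow_rdistr_int add_pow_sign_closed
        add_pow_sign_mem_ideal_iff[OF ideal_prod_is_ideal[OF I I]])
qed

lemma integral_over_ideal_quadratic:
  assumes I: "ideal I R" and x: "x \<in> carrier R" and "b \<in> I" "c \<in> I \<cdot> I"
    and eq: "x \<otimes> x \<oplus> (b \<otimes> x \<oplus> c) = \<zero>"
  shows "integral_over_ideal R I x"
proof -
  interpret I: ideal I R by (fact I)
  interpret M: comm_monoid "ideals_set R" by (rule ideals_set_is_comm_monoid)
  have "I \<in> carrier (ideals_set R)"
    using I by (simp add: ideals_set_def)
  then have pow: "I [^]\<^bsub>ideals_set R\<^esub> (1::nat) = I" "I [^]\<^bsub>ideals_set R\<^esub> (2::nat) = I \<cdot> I"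
    by (simp_all add: numeral_2_eq_2) (simp add: ideals_set_def)
  have bc: "b \<in> carrier R" "c \<in> carrier R"
    using assms I.Icarr ideal_prod_in_carrier[OF I I] by auto
  define d where "d j = (if j = (1::nat) then b else c)" for j
  have "{1..2} = {1, 2::nat}" by auto
  then have "(\<Oplus>j\<in>{1..2}. d j \<otimes> x [^] (2 - j)) = b \<otimes> x \<oplus> c"
    using x bc by (simp add: d_def finsum_insert)
  moreover have "x [^] (2::nat) = x \<otimes> x"
    using x by (simp add: numeral_2_eq_2)
  moreover have "\<forall>j\<in>{1..2}. d j \<in> I [^]\<^bsub>ideals_set R\<^esub> j"
    using assms pow \<open>{1..2} = {1, 2}\<close> by (simp add: d_def)
  ultimately show ?thesis
    unfolding integral_over_ideal_def using eq by (intro exI[of _ 2] exI[of _ d]) simp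
qed

text \<open>
  With \<open>s\<close> the sum of all terms \<open>t\<^sub>p\<close>, the equation is \<open>t\<^sub>q\<^sup>2 - s t\<^sub>q + (\<Sum>p\<noteq>q. t\<^sub>p t\<^sub>q) = 0\<close>. Its
  coefficient \<open>- s\<close> lies in \<open>I\<close> by hypothesis, and each of the products \<open>t\<^sub>p t\<^sub>q\<close> lies in \<open>I \<cdot> I\<close>.
\<close>
lemma integral_over_ideal_leibniz_term:
  assumes A: "\<forall>i j. A i j \<in> carrier R" and I: "ideal I R" and S: "finite S" "card S \<ge> 2"
    and short: "\<And>C. distinct C \<Longrightarrow> length C \<ge> 2 \<Longrightarrow> set C \<subset> S \<Longrightarrow> cycle_weight R A C \<in> I"
    and sum: "(\<Oplus>p\<in>full_cycles S. leibniz_term R A S p) \<in> I"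
    and q: "q \<in> full_cycles S"
  shows "integral_over_ideal R I (leibniz_term R A S q)"
proof -
  interpret I: ideal I R by (fact I)
  let ?t = "leibniz_term R A S"
  let ?P = "full_cycles S - {q}"
  define s where "s = (\<Oplus>p\<in>full_cycles S. ?t p)"
  define r where "r = (\<Oplus>p\<in>?P. ?t p)"
  define c where "c = (\<Oplus>p\<in>?P. ?t p \<otimes> ?t q)"
  have fin: "finite ?P"
    using S by (simp add: finite_full_cycles)
  have t: "?t p \<in> carrier R" for p
    using A by simp
  have r: "r \<in> carrier R"
    unfolding r_def using t by (intro finsum_closed) auto
  have s: "s = ?t q \<oplus> r"
  proof -
    have "full_cycles S = insert q ?P" using q by blast
    then show ?thesis
      unfolding s_def r_def using fin t by (metis (no_types, lifting) Diff_iff Pi_I finsum_insert insertI1)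
  qed
  have c: "c = r \<otimes> ?t q"
    unfolding c_def r_def using fin t by (simp add: finsum_ldistr)
  have "c \<in> I \<cdot> I"
    unfolding c_def using q
    by (intro finsum_mem_ideal ideal_prod_is_ideal I Pi_I
          leibniz_term_mult_mem_ideal_prod[OF A I S short]) auto
  moreover have "\<ominus> s \<in> I"
    using sum by (simp add: s_def I.a_inv_closed)
  moreover have "?t q \<otimes> ?t q \<oplus> (\<ominus> s \<otimes> ?t q \<oplus> c) = \<zero>"
  proof -
    have "\<ominus> s \<otimes> ?t q \<oplus> c = \<ominus> (?t q \<otimes> ?t q)"
      using t r by (simp add: s c l_minus l_distr minus_add a_assoc l_neg)
    then show ?thesis
      using t by (simp add: r_neg)
  qed
  ultimately show ?thesis
    using t by (intro integral_over_ideal_quadratic[OF I])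
qed

end


section \<open>Matrices over a quotient by an integrally closed ideal\<close>

lemma (in ideal) carrier_quot_obtains_rep:
  assumes "r \<in> carrier (R Quot I)"
  obtains x where "x \<in> carrier R" "I +> x = r"
  using assms by (auto simp: FactRing_def A_RCOSETS_def')

lemma (in ideal) rcos_eq_zero_iff:
  assumes "x \<in> carrier R"
  shows "I +> x = \<zero>\<^bsub>R Quot I\<^esub> \<longleftrightarrow> x \<in> I"
proof -
  have "\<zero>\<^bsub>R Quot I\<^esub> = I"
    by (simp add: FactRing_def)
  then show ?thesis
    using assms rcos_const_imp_mem a_rcos_zero[OF ideal_axioms] by metis
qed

context cring
begin

text \<open>
  The induction on the length of the cycle moves between the two rings: the vanishing of the Leibniz
  terms of the other permutations takes place in the quotient, the integral equation in \<open>R\<close>.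
\<close>
lemma cycle_weight_mem_ideal:
  assumes A: "\<forall>i j. A i j \<in> carrier R" and I: "ideal I R"
    and closed: "integrally_closed_ideal R I"
    and minors: "\<And>T. T \<subseteq> S \<Longrightarrow> principal_minor (R Quot I) (\<lambda>i j. I +> A i j) T = \<one>\<^bsub>R Quot I\<^esub>"
    and C: "distinct C" "length C \<ge> 2" "set C \<subseteq> S"
  shows "cycle_weight R A C \<in> I"
  using C
proof (induction "length C" arbitrary: C rule: less_induct)
  case less
  interpret I: ideal I R by (fact I)
  interpret h: ring_hom_cring R "R Quot I" "(+>) I"
    by (rule I.rcos_ring_hom_cring[OF is_cring])
  let ?B = "\<lambda>i j. I +> A i j"
  have B: "\<forall>i j. ?B i j \<in> carrier (R Quot I)"
    by (rule allI, rule allI, rule h.hom_closed, rule A[rule_format])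
  have diag: "?B i i = \<one>\<^bsub>R Quot I\<^esub>" if "i \<in> S" for i
    using minors[of "{i}"] h.S.principal_minor_singleton[of ?B i] B that by simp
  have T: "finite (set C)" "card (set C) \<ge> 2"
    using less.prems by (auto simp: distinct_card)
  have short: "cycle_weight R A E \<in> I" if "distinct E" "length E \<ge> 2" "set E \<subset> set C" for E
  proof (rule less.hyps)
    show "length E < length C"
      using psubset_card_mono[OF _ that(3)] that(1) less.prems(1) by (simp add: distinct_card)
  qed (use that less.prems in auto)
  have "(\<Oplus>\<^bsub>R Quot I\<^esub>p\<in>full_cycles (set C). leibniz_term (R Quot I) ?B (set C) p) = \<zero>\<^bsub>R Quot I\<^esub>"
  proof (rule h.S.finsum_full_cycles_eq_zero[OF B T])
    show "cycle_weight (R Quot I) ?B E = \<zero>\<^bsub>R Quot I\<^esub>"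
      if "distinct E" "length E \<ge> 2" "set E \<subset> set C" for E
      using short[OF that] A by (simp add: I.rcos_eq_zero_iff flip: h.hom_cycle_weight)
  qed (use diag minors less.prems in auto)
  then have sum: "(\<Oplus>p\<in>full_cycles (set C). leibniz_term R A (set C) p) \<in> I"
    using A by (subst I.rcos_eq_zero_iff[symmetric]) (auto intro!: finsum_closed simp: comp_def h.hom_leibniz_term)
  from less.prems have "C \<noteq> []" by auto
  then obtain q where q: "q permutes set C" "traverses q C"
    using ex_traverses less.prems(1) by metis
  then have "q \<in> full_cycles (set C)"
    by (auto simp: full_cycles_def)
  then have "integral_over_ideal R I (leibniz_term R A (set C) q)"
    using integral_over_ideal_leibniz_term[OF A I T short sum] by blast
  then have "leibniz_term R A (set C) q \<in> I"
    using closed A by (auto simp: integrally_closed_ideal_def ideal_integral_closure_def)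
  then show ?case
    using leibniz_term_set[OF A q(2)] A by (simp add: add_pow_sign_mem_ideal_iff[OF I])
qed

end

theorem theorem5p2:
  fixes D :: "('a, 'b) ring_scheme" and I :: "'a set"
    and n :: nat and A :: "nat \<Rightarrow> nat \<Rightarrow> 'a set"
  assumes "cring D"
    and "ideal I D"
    and "integrally_closed_ideal D I"
    and "matrix_over (D Quot I) n A"
    and "one_principled (D Quot I) n A"
  shows "one_nullcyclic (D Quot I) n A"
proof -
  interpret D: cring D by fact
  interpret I: ideal I D by fact
  interpret h: ring_hom_cring D "D Quot I" "(+>\<^bsub>D\<^esub>) I"
    by (rule I.rcos_ring_hom_cring[OF \<open>cring D\<close>])
  have A: "A i j \<in> carrier (D Quot I)" if "i \<in> {1..n}" "j \<in> {1..n}" for i j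
    using assms(4) that by (auto simp: matrix_over_def)
  have minor: "principal_minor (D Quot I) A S = \<one>\<^bsub>D Quot I\<^esub>" if "S \<subseteq> {1..n}" for S
    using assms(5) that by (auto simp: one_principled_def)
  have diag: "A i i = \<one>\<^bsub>D Quot I\<^esub>" if "i \<in> {1..n}" for i
    using minor[of "{i}"] h.S.principal_minor_singleton[of A i] A that by simp
  \<comment> \<open>Outside of the index range, where \<open>A\<close> is arbitrary, the lift is any element of \<open>D\<close>.\<close>
  have "\<exists>x\<in>carrier D. i \<in> {1..n} \<longrightarrow> j \<in> {1..n} \<longrightarrow> I +>\<^bsub>D\<^esub> x = A i j" for i j
    using A[of i j] D.zero_closed I.carrier_quot_obtains_rep by metis
  then obtain a where a: "\<forall>i j. a i j \<in> carrier D"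
    and aA: "\<And>i j. i \<in> {1..n} \<Longrightarrow> j \<in> {1..n} \<Longrightarrow> I +>\<^bsub>D\<^esub> a i j = A i j"
    by metis
  have "cycle_weight (D Quot I) A C = \<zero>\<^bsub>D Quot I\<^esub>" if "nontrivial_cycle n C" for C
  proof -
    have C: "distinct C" "length C \<ge> 2" "set C \<subseteq> {1..n}"
      using that by (auto simp: nontrivial_cycle_def is_cycle_def)
    have "cycle_weight D a C \<in> I"
    proof (rule D.cycle_weight_mem_ideal[OF a assms(2,3) _ C])
      fix S assume "S \<subseteq> {1..n}"
      then have "principal_minor (D Quot I) A S = principal_minor (D Quot I) (\<lambda>i j. I +>\<^bsub>D\<^esub> a i j) S"
        using a by (intro h.S.principal_minor_cong) (auto simp: aA subset_iff)
      then show "principal_minor (D Quot I) (\<lambda>i j. I +>\<^bsub>D\<^esub> a i j) S = \<one>\<^bsub>D Quot I\<^esub>"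
        using minor \<open>S \<subseteq> {1..n}\<close> by simp
    qed
    moreover have "cycle_weight (D Quot I) A C = I +>\<^bsub>D\<^esub> cycle_weight D a C"
    proof -
      have "cycle_weight (D Quot I) A C = cycle_weight (D Quot I) (\<lambda>i j. I +>\<^bsub>D\<^esub> a i j) C"
        using a C(3) by (intro h.S.cycle_weight_cong) (auto simp: aA subset_iff)
      also have "\<dots> = I +>\<^bsub>D\<^esub> cycle_weight D a C"
        by (rule h.hom_cycle_weight[OF a, symmetric])
      finally show ?thesis .
    qed
    ultimately show ?thesis
      using I.rcos_eq_zero_iff[OF D.cycle_weight_closed[OF a]] by simp
  qed
  then show ?thesis
    using diag by (simp add: one_nullcyclic_def one_diagonal_def nullcyclic_def)
qed

end
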